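(* Let $U:\mathbb{R}^+\to\mathbb{R}^+$ be a measurable function. Then: (i) For $\tau\in\mathbb{R}$: $U\in\mathcal{M}$ with $\rho_U=-\tau$ if and only if both of the following hold: $$\forall r<\tau,\ \exists x_a>1,\ \forall x\ge x_a,\quad \lim_{t\to\infty} t^r\frac{U(tx)}{U(x)}=0,$$ $$\forall r>\tau,\ \exists x_b>1,\ \forall x\ge x_b,\quad \lim_{t\to\infty} t^r\frac{U(tx)}{U(x)}=\infty.$$ (ii) $U\in\mathcal{M}_\infty$ if and only if $$\forall r\in\mathbb{R},\ \exists x_0>1,\ \forall x\ge x_0,\quad \lim_{t\to\infty} t^r\frac{U(tx)}{U(x)}=0.$$ (iii) $U\in\mathcal{M}_{-\infty}$ if and only if $$\forall r\in\mathbb{R},\ \exists x_0>1,\ \forall x\ge x_0,\quad \lim_{t\to\infty} t^r\frac{U(tx)}{U(x)}=\infty.$$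
   Context: $\mathbb{R}^+=(0,\infty)$; functions $U:\mathbb{R}^+\to\mathbb{R}^+$ are thus strictly positive. $\mathcal{M}$ is the class of measurable functions $U:\mathbb{R}^+\to\mathbb{R}^+$ for which there exists $\rho\in\mathbb{R}$ such that for all $\epsilon>0$, $\lim_{x\to\infty}U(x)/x^{\rho+\epsilon}=0$ and $\lim_{x\to\infty}U(x)/x^{\rho-\epsilon}=\infty$. Such a $\rho$ is unique and is denoted $\rho_U$. $\mathcal{M}_\infty$ is the class of measurable functions $U:\mathbb{R}^+\to\mathbb{R}^+$ such that for all $\rho\in\mathbb{R}$, $\lim_{x\to\infty}U(x)/x^{\rho}=0$. $\mathcal{M}_{-\infty}$ is the class of measurable functions $U:\mathbb{R}^+\to\mathbb{R}^+$ such that for all $\rho\in\mathbb{R}$, $\lim_{x\to\infty}U(x)/x^{\rho}=\infty$. *)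

theory Defs
  imports "HOL-Analysis.Analysis"
begin

(* A function from (0,\<infinity>) to (0,\<infinity>) is represented by a function U :: real \<Rightarrow> real of which
   only the values on {0<..} matter. "Measurable" means Lebesgue measurable on {0<..};
   Borel measurable functions are included. *)

definition pos_measurable :: "(real \<Rightarrow> real) \<Rightarrow> bool" where
  "pos_measurable U \<longleftrightarrow>
     U \<in> borel_measurable (lebesgue_on {0<..}) \<and> (\<forall>x>0. U x > 0)"

definition has_M_index :: "(real \<Rightarrow> real) \<Rightarrow> real \<Rightarrow> bool" where
  "has_M_index U \<rho> \<longleftrightarrow>
     (\<forall>\<epsilon>>0. ((\<lambda>x. U x / x powr (\<rho> + \<epsilon>)) \<longlongrightarrow> 0) at_top \<and>
            filterlim (\<lambda>x. U x / x powr (\<rho> - \<epsilon>)) at_top at_top)"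

definition class_M :: "(real \<Rightarrow> real) set" where
  "class_M = {U. pos_measurable U \<and> (\<exists>\<rho>. has_M_index U \<rho>)}"

(* Meaningful only for U \<in> class_M, where the index exists and is unique. *)
definition M_index :: "(real \<Rightarrow> real) \<Rightarrow> real" where
  "M_index U = (THE \<rho>. has_M_index U \<rho>)"

definition class_M_infty :: "(real \<Rightarrow> real) set" where
  "class_M_infty =
     {U. pos_measurable U \<and> (\<forall>\<rho>::real. ((\<lambda>x. U x / x powr \<rho>) \<longlongrightarrow> 0) at_top)}"

definition class_M_minus_infty :: "(real \<Rightarrow> real) set" where
  "class_M_minus_infty =
     {U. pos_measurable U \<and> (\<forall>\<rho>::real. filterlim (\<lambda>x. U x / x powr \<rho>) at_top at_top)}"

end

theory Submission
  imports Defs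
begin

text \<open>
  For a fixed base point \<open>x > 0\<close>, the substitution \<open>s = t * x\<close> gives
  \<open>t powr r * (U (t * x) / U x) = c * (U s / s powr (- r))\<close> with the positive constant
  \<open>c = x powr (- r) / U x\<close>. As \<open>t\<close> tends to infinity so does \<open>s\<close>, and neither a limit \<open>0\<close> nor a
  limit \<open>\<infinity>\<close> is affected by a positive constant factor. Either limit statement about the
  scaled quotient is therefore the same statement about \<open>U s / s powr (- r)\<close>
  (\<open>scaled_quotient_tendsto_0_iff\<close>, \<open>scaled_quotient_at_top_iff\<close>), so that it holds
  for one \<open>x > 0\<close> if and only if it holds for all of them. Parts (ii) and (iii) are then the
  definitions of the two classes, with \<open>\<rho> = - r\<close>.
  Part (i) is the definition of the index written with the exponents
  \<open>\<rho> + \<epsilon>\<close> and \<open>\<rho> - \<epsilon>\<close> replaced by arbitrary exponents above and below \<open>\<rho>\<close>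
  (\<open>has_M_index_iff_powr\<close>), together with the uniqueness of the index, which identifies it
  with \<open>M_index U\<close>.
\<close>

lemma scaled_quotient_eq:
  fixes U :: "real \<Rightarrow> real"
  assumes "x > 0" "t > 0"
  shows "t powr r * (U (t * x) / U x)
    = x powr (- r) / U x * (U (x * t) / (x * t) powr (- r))"
  using assms by (simp add: powr_mult powr_minus field_simps)

text \<open>
  The limit behaviour may be described by any filter that positive factors leave invariant;
  this treats the limits \<open>0\<close> and \<open>\<infinity>\<close> alike.
\<close>

lemma scaled_quotient_filterlim_iff:
  fixes U :: "real \<Rightarrow> real"
  assumes "x > 0" "U x > 0"
    and inv: "\<And>c (f :: real \<Rightarrow> real). c > 0 \<Longrightarrow>
      filterlim (\<lambda>s. c * f s) F at_top \<longleftrightarrow> filterlim f F at_top"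
  shows "filterlim (\<lambda>t. t powr r * (U (t * x) / U x)) F at_top
    \<longleftrightarrow> filterlim (\<lambda>s. U s / s powr (- r)) F at_top"
proof -
  let ?g = "\<lambda>s. U s / s powr (- r)"
  have "filterlim (\<lambda>t. t powr r * (U (t * x) / U x)) F at_top
      \<longleftrightarrow> filterlim (\<lambda>t. x powr (- r) / U x * ?g (x * t)) F at_top"
    by (intro filterlim_cong refl eventually_mono[OF eventually_gt_at_top[of 0]]
        scaled_quotient_eq assms(1))
  also have "\<dots> \<longleftrightarrow> filterlim (\<lambda>t. ?g (x * t)) F at_top"
    using assms(1,2) by (intro inv) simp
  also have "\<dots> \<longleftrightarrow> filterlim ?g F (filtermap ((*) x) at_top)"
    by (simp add: filterlim_filtermap)
  also have "filtermap ((*) x) at_top = at_top"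
  proof (rule filtermap_fun_inverse)
    show "filterlim ((*) (inverse x)) at_top at_top" "filterlim ((*) x) at_top at_top"
      using assms(1) by (auto intro: filterlim_tendsto_pos_mult_at_top[OF tendsto_const]
          filterlim_ident)
    show "\<forall>\<^sub>F s in at_top. x * (inverse x * s) = s"
      using assms(1) by simp
  qed
  finally show ?thesis .
qed

lemma scaled_quotient_tendsto_0_iff:
  fixes U :: "real \<Rightarrow> real"
  assumes "x > 0" "U x > 0"
  shows "((\<lambda>t. t powr r * (U (t * x) / U x)) \<longlongrightarrow> 0) at_top
    \<longleftrightarrow> ((\<lambda>s. U s / s powr (- r)) \<longlongrightarrow> 0) at_top"
proof (rule scaled_quotient_filterlim_iff[where U = U, OF assms])
  show "((\<lambda>s. c * f s) \<longlongrightarrow> 0) at_top \<longleftrightarrow> (f \<longlongrightarrow> 0) at_top" if "c > 0" for c and f :: "real \<Rightarrow> real"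
    using tendsto_mult_left_iff[of c f 0 at_top] that by simp
qed

lemma scaled_quotient_at_top_iff:
  fixes U :: "real \<Rightarrow> real"
  assumes "x > 0" "U x > 0"
  shows "filterlim (\<lambda>t. t powr r * (U (t * x) / U x)) at_top at_top
    \<longleftrightarrow> filterlim (\<lambda>s. U s / s powr (- r)) at_top at_top"
  by (rule scaled_quotient_filterlim_iff[where U = U, OF assms])
     (rule filterlim_tendsto_pos_mult_at_top_iff[OF tendsto_const])

lemma has_M_index_iff_powr:
  "has_M_index U \<rho> \<longleftrightarrow>
     (\<forall>s>\<rho>. ((\<lambda>x. U x / x powr s) \<longlongrightarrow> 0) at_top) \<and>
     (\<forall>s<\<rho>. filterlim (\<lambda>x. U x / x powr s) at_top at_top)"
  (is "_ \<longleftrightarrow> (\<forall>s>\<rho>. ?Z s) \<and> (\<forall>s<\<rho>. ?I s)")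
proof
  assume *: "has_M_index U \<rho>"
  have "?Z s" if "s > \<rho>" for s
    using *[unfolded has_M_index_def, rule_format, of "s - \<rho>"] that by simp
  moreover have "?I s" if "s < \<rho>" for s
    using *[unfolded has_M_index_def, rule_format, of "\<rho> - s"] that by simp
  ultimately show "(\<forall>s>\<rho>. ?Z s) \<and> (\<forall>s<\<rho>. ?I s)" by blast
qed (simp add: has_M_index_def)

text \<open>
  For two different indices, an exponent strictly between them would make the same quotient
  tend to \<open>0\<close> and to \<open>\<infinity>\<close>.
\<close>

lemma has_M_index_unique:
  assumes "has_M_index U \<rho>" "has_M_index U \<sigma>"
  shows "\<rho> = \<sigma>"
proof -
  have "\<not> \<rho> < \<sigma>" if "has_M_index U \<rho>" "has_M_index U \<sigma>" for \<rho> \<sigma>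
  proof
    assume "\<rho> < \<sigma>"
    then obtain s where "\<rho> < s" "s < \<sigma>" using dense by blast
    with that have "((\<lambda>x. U x / x powr s) \<longlongrightarrow> 0) at_top"
      and "filterlim (\<lambda>x. U x / x powr s) at_top at_top"
      by (simp_all add: has_M_index_iff_powr)
    then show False
      using not_tendsto_and_filterlim_at_infinity[OF trivial_limit_at_top_linorder]
        filterlim_at_top_imp_at_infinity by blast
  qed
  with assms show ?thesis by (meson linorder_neqE)
qed

lemma class_M_index_iff:
  assumes "pos_measurable U"
  shows "U \<in> class_M \<and> M_index U = \<rho> \<longleftrightarrow> has_M_index U \<rho>"
proof -
  have "M_index U = \<sigma>" if "has_M_index U \<sigma>" for \<sigma>
    unfolding M_index_def using that has_M_index_unique by blast
  with assms show ?thesis by (auto simp: class_M_def)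
qed

lemma all_less_uminus_iff: "(\<forall>s< - \<tau>. P s) \<longleftrightarrow> (\<forall>r>\<tau>. P (- r))" for \<tau> :: real
  by (metis minus_less_iff minus_minus)

lemma all_greater_uminus_iff: "(\<forall>s> - \<tau>. P s) \<longleftrightarrow> (\<forall>r<\<tau>. P (- r))" for \<tau> :: real
  by (metis less_minus_iff minus_minus)

lemma all_uminus_iff: "(\<forall>s. P s) \<longleftrightarrow> (\<forall>r. P (- r))" for P :: "real \<Rightarrow> bool"
  by (metis minus_minus)

lemma ex_threshold_const_iff:
  assumes "\<And>x::real. x > 1 \<Longrightarrow> P x \<longleftrightarrow> Q"
  shows "(\<exists>a>1. \<forall>x\<ge>a. P x) \<longleftrightarrow> Q"
proof
  assume "\<exists>a>1. \<forall>x\<ge>a. P x"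
  with assms show Q by blast
next
  assume Q
  with assms show "\<exists>a>1. \<forall>x\<ge>a. P x" by (intro exI[of _ 2]) auto
qed

theorem theorem1:
  fixes U :: "real \<Rightarrow> real"
  assumes "pos_measurable U"
  shows
    "(\<forall>\<tau>::real.
        (U \<in> class_M \<and> M_index U = - \<tau>) \<longleftrightarrow>
        ((\<forall>r<\<tau>. \<exists>x\<^sub>a>1. \<forall>x\<ge>x\<^sub>a. ((\<lambda>t. t powr r * (U (t * x) / U x)) \<longlongrightarrow> 0) at_top) \<and>
         (\<forall>r>\<tau>. \<exists>x\<^sub>b>1. \<forall>x\<ge>x\<^sub>b. filterlim (\<lambda>t. t powr r * (U (t * x) / U x)) at_top at_top)))
     \<and>
     (U \<in> class_M_infty \<longleftrightarrow>
        (\<forall>r::real. \<exists>x\<^sub>0>1. \<forall>x\<ge>x\<^sub>0. ((\<lambda>t. t powr r * (U (t * x) / U x)) \<longlongrightarrow> 0) at_top))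
     \<and>
     (U \<in> class_M_minus_infty \<longleftrightarrow>
        (\<forall>r::real. \<exists>x\<^sub>0>1. \<forall>x\<ge>x\<^sub>0. filterlim (\<lambda>t. t powr r * (U (t * x) / U x)) at_top at_top))"
proof -
  have pos: "U x > 0" if "x > 0" for x
    using assms that by (simp add: pos_measurable_def)
  have zero: "(\<exists>a>1. \<forall>x\<ge>a. ((\<lambda>t. t powr r * (U (t * x) / U x)) \<longlongrightarrow> 0) at_top)
      \<longleftrightarrow> ((\<lambda>s. U s / s powr (- r)) \<longlongrightarrow> 0) at_top" for r
    by (intro ex_threshold_const_iff scaled_quotient_tendsto_0_iff pos) simp_all
  have infinity: "(\<exists>a>1. \<forall>x\<ge>a. filterlim (\<lambda>t. t powr r * (U (t * x) / U x)) at_top at_top)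
      \<longleftrightarrow> filterlim (\<lambda>s. U s / s powr (- r)) at_top at_top" for r
    by (intro ex_threshold_const_iff scaled_quotient_at_top_iff pos) simp_all
  have "U \<in> class_M_infty \<longleftrightarrow> (\<forall>r. ((\<lambda>s. U s / s powr (- r)) \<longlongrightarrow> 0) at_top)"
    unfolding class_M_infty_def using assms
      all_uminus_iff[of "\<lambda>\<rho>. ((\<lambda>s. U s / s powr \<rho>) \<longlongrightarrow> 0) at_top"] by blast
  moreover have "U \<in> class_M_minus_infty
      \<longleftrightarrow> (\<forall>r. filterlim (\<lambda>s. U s / s powr (- r)) at_top at_top)"
    unfolding class_M_minus_infty_def using assms
      all_uminus_iff[of "\<lambda>\<rho>. filterlim (\<lambda>s. U s / s powr \<rho>) at_top at_top"] by blast
  ultimately show ?thesis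
    unfolding zero infinity class_M_index_iff[OF assms] has_M_index_iff_powr
      all_less_uminus_iff all_greater_uminus_iff by blast
qed

end
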